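(* Let $\alpha\in(0,1)$, $\theta^*\in\Theta$, and let $X_1,X_2,\dots$ be i.i.d. from $\mathcal P_{\theta^*}$. For $n\in\mathbb N$ and $\theta\in\Theta$ let $$R_{\boldsymbol\alpha,\boldsymbol\beta,n}(\theta)=\frac{\prod_{i=1}^n p_{\boldsymbol\alpha,\boldsymbol\beta}(X_i;\tilde\theta^1_{i-1})}{\prod_{i=1}^n p_{\boldsymbol\alpha,\boldsymbol\beta}(X_i;\theta)},\qquad D_n^\alpha=\{\theta\in\Theta: R_{\boldsymbol\alpha,\boldsymbol\beta,n}(\theta)\le 1/\alpha\},\qquad \tilde D_n^\alpha=\bigcap_{m\le n}D_m^\alpha .$$ Then the confidence sequences $(D_n^\alpha)_{n\in\mathbb N}$ and $(\tilde D_n^\alpha)_{n\in\mathbb N}$ are valid; that is, $$\mathrm{Pr}_{\theta^*}(\forall n\in\mathbb N:\theta^*\in D_n^\alpha)\ge1-\alpha\quad\text{and}\quad \mathrm{Pr}_{\theta^*}(\forall n\in\mathbb N:\theta^*\in \tilde D_n^\alpha)\ge1-\alpha .$$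
   Context: Model. $d,q\in\mathbb N$, $\mathbb X\subseteq\mathbb R^d$, $\Theta\subseteq\mathbb R^q$. $\{\mathcal P_\theta:\theta\in\Theta\}$ is a parametric family of distributions on $\mathbb X$ with probability density or mass functions $p(x;\theta)$ ("PDF" means PDF or PMF throughout). $\mathrm{Pr}_{\theta^*}$ is probability when the data $X_1,X_2,\dots$ are i.i.d. from $\mathcal P_{\theta^*}$, i.e. with PDF $p(x;\theta^* )$. Index sets. $[d]=\{1,\dots,d\}$; $\mathbb S_d$ is the set of all non-empty subsets of $[d]$; $\mathbb T_d$ is the set of all ordered pairs $T=(\overleftarrow T,\overrightarrow T)$ of disjoint non-empty subsets of $[d]$ (their union need not be $[d]$; so $|\mathbb T_d|=3^d-2^{d+1}+1$). For $x\in\mathbb R^d$ and $S\subseteq[d]$, $x_S$ is the subvector of coordinates indexed by $S$. $p(x_S;\theta)$ denotes the marginal PDF of $X_S$ and $p(x_{\overleftarrow T}\mid x_{\overrightarrow T};\theta)$ the conditional PDF of $X_{\overleftarrow T}$ given $X_{\overrightarrow T}=x_{\overrightarrow T}$ when $X\sim\mathcal P_\theta$ (a fixed version, which is a PDF in $x_{\overleftarrow T}$ for each $x_{\overrightarrow T}$). Composite likelihood. Fixed weights $\alpha_S\ge0$ ($S\in\mathbb S_d$), $\beta_T\ge0$ ($T\in\mathbb T_d$), collected in $\boldsymbol\alpha=(\alpha_S)_{S}$, $\boldsymbol\beta=(\beta_T)_{T}$, satisfy $\gamma=\sum_{S\in\mathbb S_d}\alpha_S+\sum_{T\in\mathbb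 T_d}\beta_T>0$. The individual composite likelihood is $$p_{\boldsymbol\alpha,\boldsymbol\beta}(x;\theta)=\prod_{S\in\mathbb S_d}[p(x_S;\theta)]^{\alpha_S/\gamma}\prod_{T\in\mathbb T_d}[p(x_{\overleftarrow T}\mid x_{\overrightarrow T};\theta)]^{\beta_T/\gamma}$$ (with $0^0=1$). The weights are unrelated to the scalar level $\alpha$. Estimators. Write $\mathbf X_n=(X_1,\dots,X_n)$. For each $n\in\mathbb N$, $\tilde\theta^1_{n-1}$ is an arbitrary $\Theta$-valued non-anticipating estimator, i.e. a (measurable) function of $\mathbf X_{n-1}$ only (so $\tilde\theta^1_0$ is non-random). *)

theory Defs
  imports "HOL-Probability.Probability"
begin

definition nonempty_subsets :: "'d::finite set set" where
  "nonempty_subsets = {S. S \<noteq> {}}"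

definition disjoint_pairs :: "('d::finite set \<times> 'd set) set" where
  "disjoint_pairs = {(A, B). A \<noteq> {} \<and> B \<noteq> {} \<and> A \<inter> B = {}}"

text \<open>Subvectors indexed by \<open>S\<close> are extensional functions on \<open>S\<close>, i.e. elements of
  \<open>S \<rightarrow>\<^sub>E UNIV\<close>, which is the space of the product measure \<open>PiM S\<close>.\<close>

definition subvec :: "'d::finite set \<Rightarrow> real ^ 'd \<Rightarrow> ('d \<Rightarrow> real)" where
  "subvec S x = restrict (\<lambda>i. x $ i) S"

definition sub_lborel :: "'d::finite set \<Rightarrow> ('d \<Rightarrow> real) measure" where
  "sub_lborel S = PiM S (\<lambda>_. lborel)"

text \<open>\<open>p S y\<close> stands for the density of the subvector indexed by \<open>S\<close> at \<open>y\<close>, so \<open>p UNIV\<close> is the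
  density of \<open>P\<close> itself; \<open>c (A, B) y z\<close> stands for the conditional density at \<open>y\<close> of the subvector
  indexed by \<open>A\<close>, given that the one indexed by \<open>B\<close> equals \<open>z\<close>. Densities are determined only
  almost everywhere, so \<open>p\<close> and \<open>c\<close> are arbitrary fixed versions. A conditional density is
  pinned down by the chain rule: \<open>c (A, B) y z * p B z\<close> is the joint density of the two
  subvectors; in addition it has to be a density in \<open>y\<close> for \<^emph>\<open>every\<close> \<open>z\<close>.\<close>

definition has_pdfs ::
  "(real ^ 'd::finite) measure \<Rightarrow> ('d set \<Rightarrow> ('d \<Rightarrow> real) \<Rightarrow> real) \<Rightarrow>
   ('d set \<times> 'd set \<Rightarrow> ('d \<Rightarrow> real) \<Rightarrow> ('d \<Rightarrow> real) \<Rightarrow> real) \<Rightarrow> bool" where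
  "has_pdfs P p c \<longleftrightarrow>
     (\<forall>S\<in>nonempty_subsets.
        (\<forall>y\<in>space (sub_lborel S). 0 \<le> p S y) \<and>
        distributed P (sub_lborel S) (subvec S) (\<lambda>y. ennreal (p S y))) \<and>
     (\<forall>(A, B)\<in>disjoint_pairs.
        (\<lambda>(y, z). c (A, B) y z) \<in> borel_measurable (sub_lborel A \<Otimes>\<^sub>M sub_lborel B) \<and>
        (\<forall>z\<in>space (sub_lborel B).
           (\<forall>y\<in>space (sub_lborel A). 0 \<le> c (A, B) y z) \<and>
           (\<integral>\<^sup>+ y. ennreal (c (A, B) y z) \<partial>sub_lborel A) = 1) \<and>
        distributed P (sub_lborel A \<Otimes>\<^sub>M sub_lborel B) (\<lambda>x. (subvec A x, subvec B x))
          (\<lambda>(y, z). ennreal (c (A, B) y z * p B z)))"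

text \<open>The discrete analogue. Different members of a family may live on different countable sets.
  Borel measurability of \<open>c\<close> is not automatic here, since the conditioning value \<open>z\<close> ranges over an
  uncountable set on most of which \<open>c\<close> is not determined by \<open>P\<close>.\<close>

definition has_pmfs ::
  "(real ^ 'd::finite) measure \<Rightarrow> ('d set \<Rightarrow> ('d \<Rightarrow> real) \<Rightarrow> real) \<Rightarrow>
   ('d set \<times> 'd set \<Rightarrow> ('d \<Rightarrow> real) \<Rightarrow> ('d \<Rightarrow> real) \<Rightarrow> real) \<Rightarrow> bool" where
  "has_pmfs P p c \<longleftrightarrow>
     (\<exists>C. countable C \<and> C \<subseteq> space P \<and> measure P C = 1) \<and>
     (\<forall>S\<in>nonempty_subsets. \<forall>y\<in>S \<rightarrow>\<^sub>E UNIV.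
        p S y = measure P {x \<in> space P. subvec S x = y}) \<and>
     (\<forall>(A, B)\<in>disjoint_pairs.
        (\<lambda>(y, z). c (A, B) y z)
          \<in> borel_measurable (PiM A (\<lambda>_. borel) \<Otimes>\<^sub>M PiM B (\<lambda>_. borel)) \<and>
        (\<forall>z\<in>B \<rightarrow>\<^sub>E UNIV.
           (\<forall>y\<in>A \<rightarrow>\<^sub>E UNIV. 0 \<le> c (A, B) y z) \<and>
           ((\<lambda>y. c (A, B) y z) has_sum 1) (A \<rightarrow>\<^sub>E UNIV)) \<and>
        (\<forall>y\<in>A \<rightarrow>\<^sub>E UNIV. \<forall>z\<in>B \<rightarrow>\<^sub>E UNIV.
           measure P {x \<in> space P. subvec A x = y \<and> subvec B x = z} = c (A, B) y z * p B z))"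

text \<open>Real power with \<open>0\<^sup>0 = 1\<close>; in the library \<open>0 powr 0 = 0\<close>.\<close>

definition rpow :: "real \<Rightarrow> real \<Rightarrow> real" where
  "rpow x w = (if w = 0 then 1 else x powr w)"

definition total_weight :: "('d::finite set \<Rightarrow> real) \<Rightarrow> ('d set \<times> 'd set \<Rightarrow> real) \<Rightarrow> real" where
  "total_weight a b = (\<Sum>S\<in>nonempty_subsets. a S) + (\<Sum>T\<in>disjoint_pairs. b T)"

definition comp_lik ::
  "('d::finite set \<Rightarrow> real) \<Rightarrow> ('d set \<times> 'd set \<Rightarrow> real) \<Rightarrow>
   ('d set \<Rightarrow> ('d \<Rightarrow> real) \<Rightarrow> real) \<Rightarrow>
   ('d set \<times> 'd set \<Rightarrow> ('d \<Rightarrow> real) \<Rightarrow> ('d \<Rightarrow> real) \<Rightarrow> real) \<Rightarrow> real ^ 'd \<Rightarrow> real" where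
  "comp_lik a b p c x =
     (\<Prod>S\<in>nonempty_subsets. rpow (p S (subvec S x)) (a S / total_weight a b)) *
     (\<Prod>T\<in>disjoint_pairs.
        rpow (c T (subvec (fst T) x) (subvec (snd T) x)) (b T / total_weight a b))"

text \<open>For a data sequence \<open>x 1, x 2, \<dots>\<close>: the individual composite likelihood of \<open>x i\<close>, evaluated at
  the estimate computed from \<open>x 1, \<dots>, x (i - 1)\<close> only.\<close>

definition plugin_lik ::
  "('d::finite set \<Rightarrow> real) \<Rightarrow> ('d set \<times> 'd set \<Rightarrow> real) \<Rightarrow>
   ('t \<Rightarrow> 'd set \<Rightarrow> ('d \<Rightarrow> real) \<Rightarrow> real) \<Rightarrow>
   ('t \<Rightarrow> 'd set \<times> 'd set \<Rightarrow> ('d \<Rightarrow> real) \<Rightarrow> ('d \<Rightarrow> real) \<Rightarrow> real) \<Rightarrow>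
   (nat \<Rightarrow> (nat \<Rightarrow> real ^ 'd) \<Rightarrow> 't) \<Rightarrow> nat \<Rightarrow> (nat \<Rightarrow> real ^ 'd) \<Rightarrow> real" where
  "plugin_lik a b p c est i x =
     (let t = est (i - 1) (restrict x {1..i - 1}) in comp_lik a b (p t) (c t) (x i))"

text \<open>The ratio is taken in \<open>ennreal\<close>, so that a positive number divided by \<open>0\<close> is \<open>\<infinity>\<close>
  (and not \<open>0\<close>, as it would be for reals).\<close>

definition cl_ratio ::
  "('d::finite set \<Rightarrow> real) \<Rightarrow> ('d set \<times> 'd set \<Rightarrow> real) \<Rightarrow>
   ('t \<Rightarrow> 'd set \<Rightarrow> ('d \<Rightarrow> real) \<Rightarrow> real) \<Rightarrow>
   ('t \<Rightarrow> 'd set \<times> 'd set \<Rightarrow> ('d \<Rightarrow> real) \<Rightarrow> ('d \<Rightarrow> real) \<Rightarrow> real) \<Rightarrow>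
   (nat \<Rightarrow> (nat \<Rightarrow> real ^ 'd) \<Rightarrow> 't) \<Rightarrow> (nat \<Rightarrow> real ^ 'd) \<Rightarrow> nat \<Rightarrow> 't \<Rightarrow> ennreal" where
  "cl_ratio a b p c est x n t =
     ennreal (\<Prod>i=1..n. plugin_lik a b p c est i x) /
     ennreal (\<Prod>i=1..n. comp_lik a b (p t) (c t) (x i))"

definition conf_set ::
  "('d::finite set \<Rightarrow> real) \<Rightarrow> ('d set \<times> 'd set \<Rightarrow> real) \<Rightarrow> 't set \<Rightarrow>
   ('t \<Rightarrow> 'd set \<Rightarrow> ('d \<Rightarrow> real) \<Rightarrow> real) \<Rightarrow>
   ('t \<Rightarrow> 'd set \<times> 'd set \<Rightarrow> ('d \<Rightarrow> real) \<Rightarrow> ('d \<Rightarrow> real) \<Rightarrow> real) \<Rightarrow>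
   (nat \<Rightarrow> (nat \<Rightarrow> real ^ 'd) \<Rightarrow> 't) \<Rightarrow> real \<Rightarrow> (nat \<Rightarrow> real ^ 'd) \<Rightarrow> nat \<Rightarrow> 't set" where
  "conf_set a b \<Theta> p c est \<alpha> x n = {t \<in> \<Theta>. cl_ratio a b p c est x n t \<le> ennreal (1 / \<alpha>)}"

definition running_conf_set ::
  "('d::finite set \<Rightarrow> real) \<Rightarrow> ('d set \<times> 'd set \<Rightarrow> real) \<Rightarrow> 't set \<Rightarrow>
   ('t \<Rightarrow> 'd set \<Rightarrow> ('d \<Rightarrow> real) \<Rightarrow> real) \<Rightarrow>
   ('t \<Rightarrow> 'd set \<times> 'd set \<Rightarrow> ('d \<Rightarrow> real) \<Rightarrow> ('d \<Rightarrow> real) \<Rightarrow> real) \<Rightarrow>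
   (nat \<Rightarrow> (nat \<Rightarrow> real ^ 'd) \<Rightarrow> 't) \<Rightarrow> real \<Rightarrow> (nat \<Rightarrow> real ^ 'd) \<Rightarrow> nat \<Rightarrow> 't set" where
  "running_conf_set a b \<Theta> p c est \<alpha> x n = (\<Inter>m\<in>{1..n}. conf_set a b \<Theta> p c est \<alpha> x m)"

text \<open>A non-anticipating estimator maps the first \<open>k\<close> observations measurably to \<open>\<Theta>\<close>, for each \<open>k\<close>
  (for \<open>k = 0\<close> the domain is a singleton). The second condition says that the numerator factors of
  the likelihood ratio are measurable functions of the data, so that probabilities of events about
  the ratio make sense. It follows from the first if \<open>comp_lik\<close> is jointly measurable in observation
  and parameter, and it always holds if \<open>\<X>\<close> is countable.\<close>

definition nonanticipating ::
  "('d::finite set \<Rightarrow> real) \<Rightarrow> ('d set \<times> 'd set \<Rightarrow> real) \<Rightarrow>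
   (real ^ 'd) set \<Rightarrow> (real ^ 'q::finite) set \<Rightarrow>
   (real ^ 'q \<Rightarrow> 'd set \<Rightarrow> ('d \<Rightarrow> real) \<Rightarrow> real) \<Rightarrow>
   (real ^ 'q \<Rightarrow> 'd set \<times> 'd set \<Rightarrow> ('d \<Rightarrow> real) \<Rightarrow> ('d \<Rightarrow> real) \<Rightarrow> real) \<Rightarrow>
   (nat \<Rightarrow> (nat \<Rightarrow> real ^ 'd) \<Rightarrow> real ^ 'q) \<Rightarrow> bool" where
  "nonanticipating a b \<X> \<Theta> p c est \<longleftrightarrow>
     (\<forall>k. est k \<in> PiM {1..k} (\<lambda>_. restrict_space borel \<X>) \<rightarrow>\<^sub>M restrict_space borel \<Theta>) \<and>
     (\<forall>n\<ge>1. plugin_lik a b p c est n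
        \<in> borel_measurable (PiM {1..n} (\<lambda>_. restrict_space borel \<X>)))"

end

theory Submission
  imports Defs
begin

text \<open>For fixed \<open>\<theta>\<close>, each of the ratios \<open>p(x\<^sub>S; \<theta>) / p(x\<^sub>S; \<theta>\<^sup>*)\<close> and of the corresponding ratios of
  conditional densities has expectation at most \<open>1\<close> under \<open>\<theta>\<^sup>*\<close>. The normalised weights sum to \<open>1\<close>, so
  by the weighted AM-GM inequality the ratio of individual composite likelihoods is bounded by a
  convex combination of these ratios and its expectation is at most \<open>1\<close> too. As the estimates plugged
  into the numerator depend on the past only, the running product of these ratios is a nonnegative
  supermartingale started at \<open>1\<close>, and Ville's inequality bounds the probability that it ever exceeds
  \<open>1 / \<alpha>\<close> by \<open>\<alpha>\<close>.\<close>

subsection \<open>Ville's inequality\<close>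

text \<open>The running product of the factors \<open>L i\<close>, frozen once it exceeds \<open>K \<ge> 1\<close>: it exceeds \<open>K\<close> at
  time \<open>n\<close> iff the unstopped product did so at some time up to \<open>n\<close>, so Markov's inequality for a
  single time bounds the probability of ever crossing.\<close>

primrec stopped_prod :: "real \<Rightarrow> (nat \<Rightarrow> (nat \<Rightarrow> 'a) \<Rightarrow> ennreal) \<Rightarrow> nat \<Rightarrow> (nat \<Rightarrow> 'a) \<Rightarrow> ennreal" where
  "stopped_prod K L 0 x = 1"
| "stopped_prod K L (Suc n) x =
     stopped_prod K L n x *
     (if stopped_prod K L n x > ennreal K then 1 else L (Suc n) (restrict x {1..Suc n}))"

text \<open>Serves two purposes: overwriting coordinate \<open>Suc n\<close> does not disturb the
  value at time \<open>n\<close>, and the data may be truncated to the first \<open>n\<close>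
  observations.\<close>

lemma stopped_prod_cong:
  "(\<And>i. i \<in> {1..n} \<Longrightarrow> x i = y i) \<Longrightarrow> stopped_prod K L n x = stopped_prod K L n y"
proof (induction n)
  case (Suc n)
  have "restrict x {1..Suc n} = restrict y {1..Suc n}"
    using Suc.prems by (intro restrict_ext) auto
  moreover have "stopped_prod K L n x = stopped_prod K L n y"
    using Suc.prems by (intro Suc.IH) auto
  ultimately show ?case by simp
qed simp

text \<open>The index set \<open>J\<close> stays fixed while \<open>n\<close> varies, because the
  induction step needs the value at time \<open>n\<close> as a function on the larger product
  space.\<close>

lemma measurable_stopped_prod:
  assumes "\<And>n. n \<ge> 1 \<Longrightarrow> L n \<in> borel_measurable (PiM {1..n} (\<lambda>_. N))" "{1..n} \<subseteq> J"
  shows "stopped_prod K L n \<in> borel_measurable (PiM J (\<lambda>_. N))"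
  using assms(2)
proof (induction n)
  case 0
  have "stopped_prod K L 0 = (\<lambda>_. 1)" by auto
  then show ?case by simp
next
  case (Suc n)
  have [measurable]: "stopped_prod K L n \<in> borel_measurable (PiM J (\<lambda>_. N))"
    using Suc.prems by (intro Suc.IH) auto
  have [measurable]: "(\<lambda>x. L (Suc n) (restrict x {1..Suc n})) \<in> borel_measurable (PiM J (\<lambda>_. N))"
    by (rule measurable_compose[OF measurable_restrict_subset[OF Suc.prems] assms(1)]) simp
  show ?case
    unfolding stopped_prod.simps[abs_def] by measurable
qed

text \<open>Before the first crossing the stopped product is the product itself and lies at or below
  \<open>K\<close>, so the next factor is still multiplied in; after the crossing every new factor
  is 1 and the value stays above \<open>K\<close>.\<close>

lemma stopped_prod_cases:
  fixes L :: "nat \<Rightarrow> (nat \<Rightarrow> 'a) \<Rightarrow> ennreal"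
  assumes "1 \<le> K"
  defines "Z \<equiv> \<lambda>x n. \<Prod>i=1..n. L i (restrict x {1..i})"
  shows "(if \<exists>m\<in>{1..n}. Z x m > ennreal K then stopped_prod K L n x > ennreal K
          else stopped_prod K L n x = Z x n)"
proof (induction n)
  case (Suc n)
  have *: "stopped_prod K L n x \<le> ennreal K" if "\<not> (\<exists>m\<in>{1..n}. Z x m > ennreal K)"
  proof -
    have "stopped_prod K L n x = Z x n" using Suc that by simp
    moreover have "Z x n \<le> ennreal K"
    \<comment> \<open>The assumption only concerns times from 1 on. At time 0 the empty product is
      1, which is where \<open>1 \<le> K\<close> enters.\<close>
    proof (cases "n = 0")
      case True then show ?thesis using assms by (simp add: Z_def)
    next
      case False then show ?thesis using that by (auto simp: not_less)
    qed
    ultimately show ?thesis by simp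
  qed
  have Z: "Z x (Suc n) = Z x n * L (Suc n) (restrict x {1..Suc n})"
    by (simp add: Z_def)
  have ex: "(\<exists>m\<in>{1..Suc n}. Z x m > ennreal K) \<longleftrightarrow>
      (\<exists>m\<in>{1..n}. Z x m > ennreal K) \<or> Z x (Suc n) > ennreal K"
    by (auto simp: atLeastAtMostSuc_conv)
  show ?case
  proof (cases "\<exists>m\<in>{1..n}. Z x m > ennreal K")
    case True
    then show ?thesis using Suc ex by simp
  next
    case False
    then have eq: "stopped_prod K L (Suc n) x = Z x (Suc n)"
      using Suc *[OF False] unfolding Z by (simp add: not_less[symmetric])
    show ?thesis using False unfolding eq ex by auto
  qed
qed (simp add: Z_def)

text \<open>The supermartingale step. Tonelli integrates out the last coordinate first; with the
  first \<open>n\<close> coordinates fixed, the value at time \<open>n\<close> is a constant, and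
  what remains is either the constant 1 or a factor whose integral is at most 1 by
  \<open>int\<close>. So the integral never rises above its initial value 1.\<close>

lemma nn_integral_stopped_prod_le_1:
  assumes "prob_space \<mu>" "sets \<mu> = sets N"
    and L: "\<And>n. n \<ge> 1 \<Longrightarrow> L n \<in> borel_measurable (PiM {1..n} (\<lambda>_. N))"
    and int: "\<And>n x. x \<in> space (PiM {1..n} (\<lambda>_. N)) \<Longrightarrow> (\<integral>\<^sup>+ y. L (Suc n) (x(Suc n := y)) \<partial>\<mu>) \<le> 1"
  shows "(\<integral>\<^sup>+ x. stopped_prod K L n x \<partial>PiM {1..n} (\<lambda>_. \<mu>)) \<le> 1"
proof -
  interpret \<mu>: prob_space \<mu> by fact
  interpret product_prob_space "\<lambda>_. \<mu>" by standard
  have sets_eq: "sets (PiM I (\<lambda>_. \<mu>)) = sets (PiM I (\<lambda>_. N))" for I :: "nat set"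
    by (intro sets_PiM_cong) (simp_all add: assms(2))
  have L': "n \<ge> 1 \<Longrightarrow> L n \<in> borel_measurable (PiM {1..n} (\<lambda>_. \<mu>))" for n
    using L[of n] measurable_cong_sets[OF sets_eq refl] by blast
  note [measurable] = measurable_stopped_prod[where L=L, OF L' order_refl]
  show ?thesis
  proof (induction n)
    case 0
    show ?case by (simp add: PiM_empty)
  next
    case (Suc n)
    have ins: "{1..Suc n} = insert (Suc n) {1..n}" by auto
    have "(\<integral>\<^sup>+ x. stopped_prod K L (Suc n) x \<partial>PiM {1..Suc n} (\<lambda>_. \<mu>)) =
        (\<integral>\<^sup>+ x. (\<integral>\<^sup>+ y. stopped_prod K L (Suc n) (x(Suc n := y)) \<partial>\<mu>) \<partial>PiM {1..n} (\<lambda>_. \<mu>))"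
      using measurable_stopped_prod[where L=L and n="Suc n" and K=K, OF L' order_refl] unfolding ins
      by (intro product_nn_integral_insert) (auto simp del: stopped_prod.simps)
    also have "\<dots> \<le> (\<integral>\<^sup>+ x. stopped_prod K L n x \<partial>PiM {1..n} (\<lambda>_. \<mu>))"
    proof (intro nn_integral_mono)
      fix x assume x: "x \<in> space (PiM {1..n} (\<lambda>_. \<mu>))"
      \<comment> \<open>Points of the product space are extensional, so writing into coordinate
        \<open>Suc n\<close> yields a point of the larger space and the restriction in the recursion
        disappears.\<close>
      have upd: "restrict (x(Suc n := y)) {1..Suc n} = x(Suc n := y)" for y
        using x by (auto simp: space_PiM PiE_def extensional_def fun_eq_iff)
      have W: "stopped_prod K L n (x(Suc n := y)) = stopped_prod K L n x" for y
        by (intro stopped_prod_cong) auto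
      have [measurable]: "(\<lambda>y. L (Suc n) (x(Suc n := y))) \<in> borel_measurable \<mu>"
      proof (rule measurable_compose[OF _ L'])
        show "(\<lambda>y. x(Suc n := y)) \<in> \<mu> \<rightarrow>\<^sub>M PiM {1..Suc n} (\<lambda>_. \<mu>)"
          unfolding ins by (rule measurable_component_update[OF x]) simp
      qed simp
      have *: "(\<integral>\<^sup>+ y. L (Suc n) (x(Suc n := y)) \<partial>\<mu>) \<le> 1"
        using x sets_eq_imp_space_eq[OF sets_eq] by (intro int) auto
      have "(\<integral>\<^sup>+ y. stopped_prod K L (Suc n) (x(Suc n := y)) \<partial>\<mu>) =
          stopped_prod K L n x *
          (\<integral>\<^sup>+ y. (if stopped_prod K L n x > ennreal K then 1 else L (Suc n) (x(Suc n := y))) \<partial>\<mu>)"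
        unfolding stopped_prod.simps W upd by (subst nn_integral_cmult) auto
      also have "\<dots> \<le> stopped_prod K L n x * 1"
        by (intro mult_left_mono, cases "stopped_prod K L n x > ennreal K")
          (use * in \<open>simp_all add: \<mu>.emeasure_space_1\<close>)
      finally show "(\<integral>\<^sup>+ y. stopped_prod K L (Suc n) (x(Suc n := y)) \<partial>\<mu>) \<le> stopped_prod K L n x"
        by simp
    qed
    also note Suc
    finally show ?case .
  qed
qed

text \<open>Factors may depend on the whole past, so \<open>int\<close> acts as a bound on a
  conditional expectation: the past \<open>x\<close> is fixed and only the newest coordinate is
  integrated. The events of crossing by time \<open>n\<close> increase to \<open>E\<close>, and
  Markov's inequality for the stopped product bounds each of them by \<open>1 / K\<close>.\<close>

lemma (in prob_space) ville_inequality_prod: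
  fixes L :: "nat \<Rightarrow> (nat \<Rightarrow> 'b) \<Rightarrow> ennreal"
  assumes indep: "indep_vars (\<lambda>_. N) X {1..}" and distr: "\<And>i. i \<ge> 1 \<Longrightarrow> distr M N (X i) = \<mu>"
    and L: "\<And>n. n \<ge> 1 \<Longrightarrow> L n \<in> borel_measurable (PiM {1..n} (\<lambda>_. N))"
    and int: "\<And>n x. x \<in> space (PiM {1..n} (\<lambda>_. N)) \<Longrightarrow> (\<integral>\<^sup>+ y. L (Suc n) (x(Suc n := y)) \<partial>\<mu>) \<le> 1"
    and K: "1 \<le> K"
  defines "E \<equiv> {\<omega> \<in> space M. \<exists>n\<ge>1. (\<Prod>i=1..n. L i (restrict (\<lambda>j. X j \<omega>) {1..i})) > ennreal K}"
  shows "E \<in> events" "emeasure M E \<le> ennreal (1 / K)"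
proof -
  have X: "i \<ge> 1 \<Longrightarrow> X i \<in> M \<rightarrow>\<^sub>M N" for i
    using indep by (auto simp: indep_vars_def)
  have sets: "sets \<mu> = sets N" and "prob_space \<mu>"
    using distr[of 1] X[of 1] by (auto simp flip: distr[of 1] intro: prob_space_distr)
  define V where "V = (\<lambda>n \<omega>. restrict (\<lambda>j. X j \<omega>) {1..n::nat})"
  define W where "W = (\<lambda>n \<omega>. stopped_prod K L n (V n \<omega>))"
  have V[measurable]: "V n \<in> M \<rightarrow>\<^sub>M PiM {1..n} (\<lambda>_. N)" for n
    unfolding V_def by (intro measurable_restrict) (use X in auto)
  have stopped_prod[measurable]: "stopped_prod K L n \<in> borel_measurable (PiM {1..n} (\<lambda>_. N))" for n
    using L by (intro measurable_stopped_prod) auto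
  have [measurable]: "W n \<in> borel_measurable M" for n
    unfolding W_def by measurable
  have W: "W n \<omega> = stopped_prod K L n (\<lambda>j. X j \<omega>)" for n \<omega>
    unfolding W_def V_def by (intro stopped_prod_cong) auto
  have W_gt: "W n \<omega> > ennreal K \<longleftrightarrow>
      (\<exists>m\<in>{1..n}. (\<Prod>i=1..m. L i (restrict (\<lambda>j. X j \<omega>) {1..i})) > ennreal K)" for n \<omega>
    using stopped_prod_cases[OF K, where n=n and L=L and x="\<lambda>j. X j \<omega>"] K
    by (cases "n = 0") (auto simp: W split: if_splits)
  have W_int: "(\<integral>\<^sup>+ \<omega>. W n \<omega> \<partial>M) \<le> 1" for n
  \<comment> \<open>The product form of the joint law is for nonempty index sets; for
    \<open>n = 0\<close> the stopped product is the constant 1.\<close>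
  proof (cases "n = 0")
    case True
    then show ?thesis by (simp add: W_def emeasure_space_1)
  next
    case False
    \<comment> \<open>Independence enters here: the joint law of the first \<open>n\<close>
      observations is the product of their individual laws.\<close>
    have "distr M (PiM {1..n} (\<lambda>_. N)) (V n) = PiM {1..n} (\<lambda>i. distr M N (X i))"
      using indep_vars_iff_distr_eq_PiM'[where I="{1..n}" and M'="\<lambda>_. N" and X=X]
        indep_vars_subset[OF indep, of "{1..n}"] X False unfolding V_def by force
    also have "\<dots> = PiM {1..n} (\<lambda>_. \<mu>)"
      by (intro PiM_cong) (auto simp: distr)
    finally have VD: "distr M (PiM {1..n} (\<lambda>_. N)) (V n) = PiM {1..n} (\<lambda>_. \<mu>)" .
    have "(\<integral>\<^sup>+ \<omega>. W n \<omega> \<partial>M) = (\<integral>\<^sup>+ x. stopped_prod K L n x \<partial>PiM {1..n} (\<lambda>_. \<mu>))"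
      unfolding W_def VD[symmetric] by (rule nn_integral_distr[OF V, symmetric])
        (simp only: measurable_distr_eq1 stopped_prod)
    also have "\<dots> \<le> 1"
      using \<open>prob_space \<mu>\<close> sets L int by (rule nn_integral_stopped_prod_le_1)
    finally show ?thesis .
  qed
  define F where "F = (\<lambda>n. {\<omega>\<in>space M. W n \<omega> > ennreal K})"
  have "F n \<in> events" for n
    unfolding F_def by measurable
  moreover have "incseq F"
    unfolding F_def by (auto simp: incseq_def W_gt)
  ultimately have F: "range F \<subseteq> events" "incseq F"
    by auto
  have E: "E = (\<Union>n. F n)"
    unfolding E_def F_def W_gt by (auto simp: Bex_def)
  show "E \<in> events" using F E by auto
  have "emeasure M (F n) \<le> ennreal (1 / K)" for n
  proof -
    have "emeasure M (F n) \<le> emeasure M {\<omega>\<in>space M. 1 \<le> ennreal (1 / K) * W n \<omega>}"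
    proof (intro emeasure_mono)
      have "1 \<le> ennreal (1 / K) * W n \<omega>" if "ennreal K < W n \<omega>" for \<omega>
      proof -
        have "1 = ennreal (1 / K) * ennreal K"
          using K by (simp flip: ennreal_mult)
        also have "\<dots> \<le> ennreal (1 / K) * W n \<omega>"
          using that by (intro mult_left_mono) auto
        finally show ?thesis .
      qed
      then show "F n \<subseteq> {\<omega>\<in>space M. 1 \<le> ennreal (1 / K) * W n \<omega>}"
        by (auto simp: F_def)
    qed measurable
    also have "\<dots> \<le> ennreal (1 / K) * (\<integral>\<^sup>+ \<omega>. W n \<omega> * indicator (space M) \<omega> \<partial>M)"
      by (rule nn_integral_Markov_inequality) auto
    also have "(\<integral>\<^sup>+ \<omega>. W n \<omega> * indicator (space M) \<omega> \<partial>M) = (\<integral>\<^sup>+ \<omega>. W n \<omega> \<partial>M)"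
      by (intro nn_integral_cong) auto
    also have "ennreal (1 / K) * \<dots> \<le> ennreal (1 / K) * 1"
      by (intro mult_left_mono W_int) auto
    finally show ?thesis by simp
  qed
  then show "emeasure M E \<le> ennreal (1 / K)"
    unfolding E SUP_emeasure_incseq[OF F, symmetric] by (intro SUP_least)
qed

subsection \<open>Weighted geometric means of likelihood ratios\<close>

text \<open>Real division suffices in the integral although \<open>f x / 0 = 0\<close>, since \<open>g\<close> is almost everywhere
  positive.\<close>

definition sub_likelihood_ratio :: "'a measure \<Rightarrow> ('a \<Rightarrow> real) \<Rightarrow> ('a \<Rightarrow> real) \<Rightarrow> bool" where
  "sub_likelihood_ratio M f g \<longleftrightarrow>
     f \<in> borel_measurable M \<and> g \<in> borel_measurable M \<and>
     (\<forall>x\<in>space M. 0 \<le> f x \<and> 0 \<le> g x) \<and> (AE x in M. 0 < g x) \<and>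
     (\<integral>\<^sup>+ x. ennreal (f x / g x) \<partial>M) \<le> 1"

text \<open>Weighted AM-GM with zeros allowed. If a zero carries positive weight, the left side
  vanishes; otherwise Jensen's inequality for the concave logarithm applies to the indices of
  nonzero weight.\<close>

lemma prod_rpow_le_weighted_sum:
  assumes "finite I" "\<And>i. i \<in> I \<Longrightarrow> 0 \<le> w i" "sum w I = 1" "\<And>i. i \<in> I \<Longrightarrow> 0 \<le> x i"
  shows "(\<Prod>i\<in>I. rpow (x i) (w i)) \<le> (\<Sum>i\<in>I. w i * x i)"
proof (cases "\<exists>i\<in>I. x i = 0 \<and> w i \<noteq> 0")
  case True
  then have "(\<Prod>i\<in>I. rpow (x i) (w i)) = 0"
    using assms(1) by (auto simp: rpow_def)
  moreover have "0 \<le> (\<Sum>i\<in>I. w i * x i)"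
    using assms by (intro sum_nonneg) auto
  ultimately show ?thesis by simp
next
  case False
  \<comment> \<open>Indices of weight 0 contribute the factor 1 and the summand 0, even when
    \<open>x i = 0\<close>. Without them all \<open>x i\<close> are positive and logarithms may be
    taken.\<close>
  define J where "J = {i\<in>I. w i \<noteq> 0}"
  have J: "finite J" "\<And>i. i \<in> J \<Longrightarrow> 0 < x i" "\<And>i. i \<in> J \<Longrightarrow> 0 \<le> w i"
    using assms False by (auto simp: J_def less_le)
  have sumJ: "sum w J = 1"
    unfolding assms(3)[symmetric] J_def by (intro sum.mono_neutral_left) (use assms in auto)
  then have "J \<noteq> {}" by auto
  have pos: "0 < (\<Sum>i\<in>J. w i * x i)"
    by (intro sum_pos) (use J \<open>J \<noteq> {}\<close> in \<open>auto simp: J_def less_le\<close>)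
  have "(\<Sum>i\<in>J. w i * ln (x i)) \<le> ln (\<Sum>i\<in>J. w i *\<^sub>R x i)"
    by (intro concave_on_sum[where C="{0<..}"]) (use J sumJ \<open>J \<noteq> {}\<close> ln_concave in auto)
  then have "exp (\<Sum>i\<in>J. w i * ln (x i)) \<le> (\<Sum>i\<in>J. w i * x i)"
    using pos by (simp add: ln_ge_iff)
  also have "exp (\<Sum>i\<in>J. w i * ln (x i)) = (\<Prod>i\<in>J. rpow (x i) (w i))"
    unfolding exp_sum[OF J(1)]
    by (intro prod.cong) (use J in \<open>force simp: rpow_def powr_def J_def\<close>)+
  also have "\<dots> = (\<Prod>i\<in>I. rpow (x i) (w i))"
    unfolding J_def by (intro prod.mono_neutral_left) (use assms in \<open>auto simp: rpow_def\<close>)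
  also have "(\<Sum>i\<in>J. w i * x i) = (\<Sum>i\<in>I. w i * x i)"
    unfolding J_def by (intro sum.mono_neutral_left) (use assms in auto)
  finally show ?thesis .
qed

lemma rpow_nonneg: "0 \<le> rpow x w"
  by (simp add: rpow_def)

lemma rpow_pos: "0 < x \<Longrightarrow> 0 < rpow x w"
  by (simp add: rpow_def)

text \<open>This includes \<open>y = 0\<close>: for nonzero \<open>w\<close> both sides are 0, as
  real division by 0 gives 0 and \<open>0 powr w = 0\<close>.\<close>

lemma rpow_divide: "0 \<le> x \<Longrightarrow> 0 \<le> y \<Longrightarrow> rpow (x / y) w = rpow x w / rpow y w"
  by (simp add: rpow_def powr_divide)

lemma borel_measurable_rpow [measurable]:
  "f \<in> borel_measurable M \<Longrightarrow> (\<lambda>x. rpow (f x) w) \<in> borel_measurable M"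
  by (cases "w = 0") (simp_all add: rpow_def)

text \<open>The ratio of two geometric means is the geometric mean of the ratios, hence at most
  their arithmetic mean with weights \<open>w\<close>. After integration each ratio contributes at
  most \<open>w i\<close>, and the weights add up to 1.\<close>

lemma sub_likelihood_ratio_prod:
  assumes I: "finite I" "\<And>i. i \<in> I \<Longrightarrow> 0 \<le> w i" "sum w I = 1"
    and lr: "\<And>i. i \<in> I \<Longrightarrow> sub_likelihood_ratio M (f i) (g i)"
  shows "sub_likelihood_ratio M (\<lambda>x. \<Prod>i\<in>I. rpow (f i x) (w i)) (\<lambda>x. \<Prod>i\<in>I. rpow (g i x) (w i))"
proof -
  have [measurable]: "i \<in> I \<Longrightarrow> f i \<in> borel_measurable M" "i \<in> I \<Longrightarrow> g i \<in> borel_measurable M" for i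
    using lr by (auto simp: sub_likelihood_ratio_def)
  have nonneg: "0 \<le> f i x" "0 \<le> g i x" if "i \<in> I" "x \<in> space M" for i x
    using lr[OF that(1)] that(2) by (auto simp: sub_likelihood_ratio_def)
  have "AE x in M. \<forall>i\<in>I. 0 < g i x"
    using lr \<open>finite I\<close> by (intro AE_finite_allI) (auto simp: sub_likelihood_ratio_def)
  then have pos: "AE x in M. 0 < (\<Prod>i\<in>I. rpow (g i x) (w i))"
    by eventually_elim (auto intro!: prod_pos rpow_pos)
  have "(\<integral>\<^sup>+ x. ennreal ((\<Prod>i\<in>I. rpow (f i x) (w i)) / (\<Prod>i\<in>I. rpow (g i x) (w i))) \<partial>M)
      \<le> (\<integral>\<^sup>+ x. (\<Sum>i\<in>I. ennreal (w i) * ennreal (f i x / g i x)) \<partial>M)"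
  proof (intro nn_integral_mono)
    fix x assume x: "x \<in> space M"
    have "(\<Prod>i\<in>I. rpow (f i x) (w i)) / (\<Prod>i\<in>I. rpow (g i x) (w i)) = (\<Prod>i\<in>I. rpow (f i x / g i x) (w i))"
      unfolding prod_dividef[symmetric] using nonneg x by (intro prod.cong) (auto simp: rpow_divide)
    also have "\<dots> \<le> (\<Sum>i\<in>I. w i * (f i x / g i x))"
      using I nonneg x by (intro prod_rpow_le_weighted_sum) auto
    finally show "ennreal ((\<Prod>i\<in>I. rpow (f i x) (w i)) / (\<Prod>i\<in>I. rpow (g i x) (w i)))
        \<le> (\<Sum>i\<in>I. ennreal (w i) * ennreal (f i x / g i x))"
      using I nonneg x by (simp add: sum_ennreal ennreal_leI flip: ennreal_mult)
  qed
  also have "\<dots> = (\<Sum>i\<in>I. ennreal (w i) * (\<integral>\<^sup>+ x. ennreal (f i x / g i x) \<partial>M))"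
    by (simp add: nn_integral_sum nn_integral_cmult)
  also have "\<dots> \<le> (\<Sum>i\<in>I. ennreal (w i) * 1)"
    using lr by (intro sum_mono mult_left_mono) (auto simp: sub_likelihood_ratio_def)
  also have "\<dots> = 1"
    using I by (simp add: sum_ennreal)
  finally show ?thesis
    using pos by (auto simp: sub_likelihood_ratio_def intro!: prod_nonneg rpow_nonneg)
qed

text \<open>Denominators may vanish, so quotients can be infinite. The inverse of a product still
  splits because all factors are finite, which excludes 0 times infinity.\<close>

lemma ennreal_prod_divide:
  assumes "finite A" "\<And>i. i \<in> A \<Longrightarrow> 0 \<le> f i" "\<And>i. i \<in> A \<Longrightarrow> 0 \<le> g i"
  shows "(\<Prod>i\<in>A. ennreal (f i) / ennreal (g i)) = ennreal (\<Prod>i\<in>A. f i) / ennreal (\<Prod>i\<in>A. g i)"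
  using assms
proof (induction A)
  case (insert i A)
  have "inverse (ennreal (g i * prod g A)) = inverse (ennreal (g i)) * inverse (ennreal (prod g A))"
    using insert.prems by (subst ennreal_mult) (auto intro!: prod_nonneg ennreal_inverse_mult)
  moreover have "ennreal (f i * prod f A) = ennreal (f i) * ennreal (prod f A)"
    using insert.prems by (intro ennreal_mult) (auto intro!: prod_nonneg)
  ultimately show ?case
    using insert by (simp add: divide_ennreal_def mult_ac)
qed simp

text \<open>Passes between the two conventions for a zero denominator: they can differ only where
  \<open>g\<close> vanishes, which is a null set.\<close>

lemma sub_likelihood_ratio_ennreal:
  assumes "sub_likelihood_ratio M f g"
  shows "(\<integral>\<^sup>+ x. ennreal (f x) / ennreal (g x) \<partial>M) \<le> 1"
proof -
  have "(\<integral>\<^sup>+ x. ennreal (f x) / ennreal (g x) \<partial>M) = (\<integral>\<^sup>+ x. ennreal (f x / g x) \<partial>M)"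
  proof (rule nn_integral_cong_AE)
    have "AE x in M. 0 < g x" using assms by (auto simp: sub_likelihood_ratio_def)
    with AE_space show "AE x in M. ennreal (f x) / ennreal (g x) = ennreal (f x / g x)"
      by eventually_elim (use assms in \<open>auto simp: sub_likelihood_ratio_def divide_ennreal\<close>)
  qed
  then show ?thesis using assms by (simp add: sub_likelihood_ratio_def)
qed

subsection \<open>Densities\<close>

text \<open>The law with density \<open>f\<close> gives no mass to the set where that density
  vanishes.\<close>

lemma distributed_AE_pos:
  assumes "distributed M N X (\<lambda>y. ennreal (f y))"
  shows "AE x in M. 0 < f (X x)"
proof -
  note [measurable] = distributed_measurable[OF assms] distributed_borel_measurable[OF assms]
  have "AE y in distr M N X. 0 < ennreal (f y)"
    unfolding distributed_distr_eq_density[OF assms] by (subst AE_density) auto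
  then have "AE x in M. 0 < ennreal (f (X x))"
    by (subst (asm) AE_distr_iff) measurable
  then show ?thesis by simp
qed

text \<open>The factor \<open>h\<close> lets one lemma serve both kinds of ratio: it is 1 for
  marginals and the density of the conditioning subvector for conditionals. In the integral against
  \<open>g y * h y\<close> the factor \<open>g\<close> cancels, leaving \<open>f y * h y\<close>
  where \<open>g\<close> is positive and 0 elsewhere; hence only an inequality.\<close>

lemma sub_likelihood_ratio_distributed:
  assumes X: "distributed M N X (\<lambda>y. ennreal (g y * h y))"
    and [measurable]: "f \<in> borel_measurable N" "g \<in> borel_measurable N"
    and nonneg: "\<And>y. y \<in> space N \<Longrightarrow> 0 \<le> f y" "\<And>y. y \<in> space N \<Longrightarrow> 0 \<le> g y"
      "\<And>y. y \<in> space N \<Longrightarrow> 0 \<le> h y"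
    and int: "(\<integral>\<^sup>+ y. ennreal (f y * h y) \<partial>N) \<le> 1"
  shows "sub_likelihood_ratio M (\<lambda>x. f (X x)) (\<lambda>x. g (X x))"
proof -
  note [measurable] = distributed_measurable[OF X]
  have X_in: "x \<in> space M \<Longrightarrow> X x \<in> space N" for x
    using distributed_measurable[OF X] by (rule measurable_space)
  have "(\<integral>\<^sup>+ x. ennreal (f (X x) / g (X x)) \<partial>M) = (\<integral>\<^sup>+ y. ennreal (g y * h y) * ennreal (f y / g y) \<partial>N)"
    by (rule distributed_nn_integral[OF X, symmetric]) measurable
  also have "\<dots> \<le> (\<integral>\<^sup>+ y. ennreal (f y * h y) \<partial>N)"
  proof (intro nn_integral_mono)
    fix y assume y: "y \<in> space N"
    show "ennreal (g y * h y) * ennreal (f y / g y) \<le> ennreal (f y * h y)"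
      using nonneg[OF y] by (cases "g y = 0") (auto simp flip: ennreal_mult simp: ac_simps)
  qed
  also note int
  finally have "(\<integral>\<^sup>+ x. ennreal (f (X x) / g (X x)) \<partial>M) \<le> 1" .
  \<comment> \<open>Where \<open>g\<close> vanishes so does the full density
    \<open>g y * h y\<close>, which is almost surely positive along \<open>X\<close>.\<close>
  moreover have "AE x in M. 0 < g (X x)"
    using distributed_AE_pos[OF X] AE_space
  proof eventually_elim
    case (elim x)
    then show ?case
      using nonneg(2)[OF X_in, of x] by (cases "g (X x) = 0") auto
  qed
  ultimately show ?thesis
    using nonneg X_in by (auto simp: sub_likelihood_ratio_def)
qed

lemma sigma_finite_sub_lborel: "sigma_finite_measure (sub_lborel S)"
  unfolding sub_lborel_def
  by (intro product_sigma_finite.sigma_finite product_sigma_finite.intro)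
    (simp_all add: lborel.sigma_finite_measure_axioms)

lemma nn_integral_distributed:
  assumes "prob_space M" "distributed M N X f"
  shows "(\<integral>\<^sup>+ y. f y \<partial>N) = 1"
  using distributed_nn_integral[OF assms(2), of "\<lambda>_. 1"] prob_space.emeasure_space_1[OF assms(1)]
  by simp

text \<open>With \<open>h = 1\<close> the remaining integral is that of \<open>p' S\<close>, which
  is 1 because \<open>p' S\<close> is the density of the subvector under \<open>Q\<close>.\<close>

lemma has_pdfs_marginal_ratio:
  assumes "prob_space P" "prob_space Q" "has_pdfs P p c" "has_pdfs Q p' c'" "S \<in> nonempty_subsets"
  shows "sub_likelihood_ratio P (\<lambda>x. p' S (subvec S x)) (\<lambda>x. p S (subvec S x))"
proof (rule sub_likelihood_ratio_distributed[where N="sub_lborel S" and h="\<lambda>_. 1"])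
  have p: "distributed P (sub_lborel S) (subvec S) (\<lambda>y. ennreal (p S y))"
      "\<And>y. y \<in> space (sub_lborel S) \<Longrightarrow> 0 \<le> p S y"
    and p': "distributed Q (sub_lborel S) (subvec S) (\<lambda>y. ennreal (p' S y))"
      "\<And>y. y \<in> space (sub_lborel S) \<Longrightarrow> 0 \<le> p' S y"
    using assms(3-5) by (auto simp: has_pdfs_def)
  show "distributed P (sub_lborel S) (subvec S) (\<lambda>y. ennreal (p S y * 1))"
    using p by simp
  show "p S \<in> borel_measurable (sub_lborel S)" "p' S \<in> borel_measurable (sub_lborel S)"
    using distributed_real_measurable p p' by blast+
  show "(\<integral>\<^sup>+ y. ennreal (p' S y * 1) \<partial>sub_lborel S) \<le> 1"
    using nn_integral_distributed[OF assms(2) p'(1)] by simp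
qed (use assms(3-5) in \<open>auto simp: has_pdfs_def\<close>)

text \<open>Here \<open>h\<close> is the density of the conditioning subvector under
  \<open>P\<close>, while \<open>c'\<close> belongs to \<open>Q\<close>. The mixed function
  \<open>c' (A, B) y z * p B z\<close> still integrates to 1: integrate over \<open>y\<close> first,
  using that \<open>c'\<close> is a density in \<open>y\<close> for every \<open>z\<close>,
  including those that \<open>Q\<close> does not charge.\<close>

lemma has_pdfs_conditional_ratio:
  assumes "prob_space P" "has_pdfs P p c" "has_pdfs Q p' c'" "T \<in> disjoint_pairs"
  shows "sub_likelihood_ratio P (\<lambda>x. c' T (subvec (fst T) x) (subvec (snd T) x))
    (\<lambda>x. c T (subvec (fst T) x) (subvec (snd T) x))"
proof -
  obtain A B where T: "T = (A, B)" by force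
  let ?A = "sub_lborel A" and ?B = "sub_lborel B"
  interpret A: sigma_finite_measure ?A by (rule sigma_finite_sub_lborel)
  interpret B: sigma_finite_measure ?B by (rule sigma_finite_sub_lborel)
  interpret AB: pair_sigma_finite ?A ?B ..
  have "B \<in> nonempty_subsets"
    using assms(4) by (auto simp: T disjoint_pairs_def nonempty_subsets_def)
  then have pB: "distributed P ?B (subvec B) (\<lambda>z. ennreal (p B z))"
      "\<And>z. z \<in> space ?B \<Longrightarrow> 0 \<le> p B z"
    using assms(2) by (auto simp: has_pdfs_def)
  have c: "(\<lambda>(y, z). c (A, B) y z) \<in> borel_measurable (?A \<Otimes>\<^sub>M ?B)"
      "\<And>y z. z \<in> space ?B \<Longrightarrow> y \<in> space ?A \<Longrightarrow> 0 \<le> c (A, B) y z"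
      "distributed P (?A \<Otimes>\<^sub>M ?B) (\<lambda>x. (subvec A x, subvec B x)) (\<lambda>(y, z). ennreal (c (A, B) y z * p B z))"
    and c': "(\<lambda>(y, z). c' (A, B) y z) \<in> borel_measurable (?A \<Otimes>\<^sub>M ?B)"
      "\<And>y z. z \<in> space ?B \<Longrightarrow> y \<in> space ?A \<Longrightarrow> 0 \<le> c' (A, B) y z"
      "\<And>z. z \<in> space ?B \<Longrightarrow> (\<integral>\<^sup>+ y. ennreal (c' (A, B) y z) \<partial>?A) = 1"
    using assms(2-4) by (auto simp: has_pdfs_def T)
  note [measurable] = c(1) c'(1) distributed_real_measurable[OF pB(2,1)]
  have "sub_likelihood_ratio P (\<lambda>x. (\<lambda>(y, z). c' (A, B) y z) (subvec A x, subvec B x))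
      (\<lambda>x. (\<lambda>(y, z). c (A, B) y z) (subvec A x, subvec B x))"
  proof (rule sub_likelihood_ratio_distributed[where N="?A \<Otimes>\<^sub>M ?B" and h="\<lambda>(y, z). p B z"])
    show "distributed P (?A \<Otimes>\<^sub>M ?B) (\<lambda>x. (subvec A x, subvec B x))
        (\<lambda>y. ennreal ((case y of (y, z) \<Rightarrow> c (A, B) y z) * (case y of (y, z) \<Rightarrow> p B z)))"
      using c(3) by (simp add: case_prod_beta')
    have "(\<integral>\<^sup>+ y. ennreal ((case y of (y, z) \<Rightarrow> c' (A, B) y z) * (case y of (y, z) \<Rightarrow> p B z)) \<partial>(?A \<Otimes>\<^sub>M ?B))
        = (\<integral>\<^sup>+ z. (\<integral>\<^sup>+ y. ennreal (c' (A, B) y z * p B z) \<partial>?A) \<partial>?B)"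
      by (subst AB.nn_integral_snd[symmetric]) auto
    also have "\<dots> = (\<integral>\<^sup>+ z. ennreal (p B z) \<partial>?B)"
    proof (intro nn_integral_cong)
      fix z assume z: "z \<in> space ?B"
      have "(\<integral>\<^sup>+ y. ennreal (c' (A, B) y z * p B z) \<partial>?A)
          = (\<integral>\<^sup>+ y. ennreal (c' (A, B) y z) * ennreal (p B z) \<partial>?A)"
        by (intro nn_integral_cong) (auto simp: ennreal_mult c'(2) pB z)
      also have "\<dots> = ennreal (p B z)"
        using z c'(3)[OF z] by (subst nn_integral_multc) auto
      finally show "(\<integral>\<^sup>+ y. ennreal (c' (A, B) y z * p B z) \<partial>?A) = ennreal (p B z)" .
    qed
    finally show "(\<integral>\<^sup>+ y. ennreal ((case y of (y, z) \<Rightarrow> c' (A, B) y z) *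
        (case y of (y, z) \<Rightarrow> p B z)) \<partial>(?A \<Otimes>\<^sub>M ?B)) \<le> 1"
      using nn_integral_distributed[OF assms(1) pB(1)] by simp
  qed (use c c' pB in \<open>auto simp: space_pair_measure\<close>)
  then show ?thesis by (simp add: T)
qed

subsection \<open>Mass functions\<close>

lemma fibre_in_sets:
  assumes "Y \<in> M \<rightarrow>\<^sub>M N" "{y} \<in> sets N"
  shows "{x \<in> space M. Y x = y} \<in> sets M"
  using measurable_sets[OF assms] by (simp add: vimage_def Int_def conj_commute)

text \<open>Almost surely \<open>h (Y x)\<close> is a sum over \<open>D\<close> of
  \<open>h y\<close> times the indicator of the fibre over \<open>y\<close>, with a single nonzero
  term at most; countability of \<open>D\<close> allows sum and integral to be exchanged.\<close>

lemma nn_integral_countable_range: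
  assumes Y[measurable]: "Y \<in> M \<rightarrow>\<^sub>M N" and h[measurable]: "h \<in> borel_measurable N"
    and D: "countable D" "\<And>y. y \<in> D \<Longrightarrow> {y} \<in> sets N" "AE x in M. Y x \<in> D"
  shows "(\<integral>\<^sup>+ x. h (Y x) \<partial>M) = (\<integral>\<^sup>+ y. h y * emeasure M {x \<in> space M. Y x = y} \<partial>count_space D)"
proof -
  have sets: "y \<in> D \<Longrightarrow> {x \<in> space M. Y x = y} \<in> sets M" for y
    using Y D(2) by (rule fibre_in_sets)
  have "(\<integral>\<^sup>+ x. h (Y x) \<partial>M) =
      (\<integral>\<^sup>+ x. (\<integral>\<^sup>+ y. h y * indicator {x \<in> space M. Y x = y} x \<partial>count_space D) \<partial>M)"
  proof (rule nn_integral_cong_AE)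
    show "AE x in M. h (Y x) = (\<integral>\<^sup>+ y. h y * indicator {x \<in> space M. Y x = y} x \<partial>count_space D)"
      using D(3) AE_space
    proof eventually_elim
      case (elim x)
      have "(\<integral>\<^sup>+ y. h y * indicator {x \<in> space M. Y x = y} x \<partial>count_space D) =
          (\<integral>\<^sup>+ y. h y * indicator {Y x} y \<partial>count_space D)"
        using elim by (intro nn_integral_cong) (auto split: split_indicator)
      also have "\<dots> = h (Y x)"
        using elim by (subst nn_integral_indicator_singleton) auto
      finally show ?case by simp
    qed
  qed
  also have "\<dots> = (\<integral>\<^sup>+ y. (\<integral>\<^sup>+ x. h y * indicator {x \<in> space M. Y x = y} x \<partial>M) \<partial>count_space D)"
    using D(1) sets by (intro nn_integral_count_space_nn_integral) auto
  also have "\<dots> = (\<integral>\<^sup>+ y. h y * emeasure M {x \<in> space M. Y x = y} \<partial>count_space D)"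
    using sets by (intro nn_integral_cong nn_integral_cmult_indicator) auto
  finally show ?thesis .
qed

text \<open>Turns a sum over a possibly uncountable index set into an integral against counting
  measure; passing to \<open>D\<close> only drops nonnegative terms.\<close>

lemma nn_integral_has_sum_subset_le:
  fixes f :: "'a \<Rightarrow> real"
  assumes "(f has_sum s) A" "\<And>x. x \<in> A \<Longrightarrow> 0 \<le> f x" "D \<subseteq> A"
  shows "(\<integral>\<^sup>+ x. ennreal (f x) \<partial>count_space D) \<le> ennreal s"
proof -
  have "f summable_on A" using assms(1) by (rule has_sum_imp_summable)
  then have abs: "Infinite_Set_Sum.abs_summable_on f A"
    unfolding abs_summable_equivalent[symmetric] by (rule summable_on_iff_abs_summable_on_real[THEN iffD1])
  have "(\<integral>\<^sup>+ x. ennreal (f x) \<partial>count_space D) =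
      (\<integral>\<^sup>+ x. ennreal (f x) * indicator D x \<partial>count_space A)"
    using nn_integral_restrict_space[of D "count_space A" "\<lambda>x. ennreal (f x)"] assms(3)
    by (simp add: restrict_count_space inf.absorb1)
  also have "\<dots> \<le> (\<integral>\<^sup>+ x. ennreal (f x) \<partial>count_space A)"
    by (intro nn_integral_mono) (auto split: split_indicator)
  also have "\<dots> = ennreal (infsetsum f A)"
    using abs assms(2) by (rule nn_integral_conv_infsetsum)
  also have "infsetsum f A = s"
    using infsetsum_infsum[OF abs] infsumI[OF assms(1)] by simp
  finally show ?thesis .
qed

lemma singleton_in_sets_PiM_borel:
  assumes "finite S" "y \<in> S \<rightarrow>\<^sub>E UNIV"
  shows "{y} \<in> sets (PiM S (\<lambda>_. borel :: real measure))"
proof -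
  have "{y} = (\<Pi>\<^sub>E i\<in>S. {y i})"
    using assms(2) by (subst PiE_singleton) (auto simp: PiE_def)
  also have "\<dots> \<in> sets (PiM S (\<lambda>_. borel))"
    using assms(1) by (intro sets_PiM_I_finite) auto
  finally show ?thesis .
qed

lemma subvec_in_PiE: "subvec S x \<in> S \<rightarrow>\<^sub>E UNIV"
  by (simp add: subvec_def)

lemma measurable_subvec:
  assumes "sets P = sets (restrict_space borel \<X>)"
  shows "subvec S \<in> P \<rightarrow>\<^sub>M PiM S (\<lambda>_. borel)"
proof -
  have "(\<lambda>x. \<lambda>i\<in>S. x $ i) \<in> restrict_space borel \<X> \<rightarrow>\<^sub>M PiM S (\<lambda>_. borel)"
    by (intro measurable_restrict measurable_restrict_space1) auto
  then show ?thesis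
    unfolding measurable_cong_sets[OF assms refl] subvec_def[abs_def] .
qed

lemma AE_mem_of_measure_eq_1:
  assumes "prob_space P" "measure P C = 1"
  shows "AE x in P. x \<in> C"
proof -
  interpret prob_space P by fact
  \<comment> \<open>Sets that are not measurable have \<open>measure\<close> 0 by default, so
    measure 1 forces measurability.\<close>
  have "C \<in> events" using assms(2) measure_notin_sets by fastforce
  then show ?thesis using assms(2) by (subst prob_eq_1[symmetric]) auto
qed

lemma borel_measurable_marginal_pmf:
  assumes P: "prob_space P" "subvec S \<in> P \<rightarrow>\<^sub>M PiM S (\<lambda>_. borel)"
    and C: "countable C" "measure P C = 1"
    and pS: "\<And>y. y \<in> S \<rightarrow>\<^sub>E UNIV \<Longrightarrow> f y = measure P {x \<in> space P. subvec S x = y}"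
  shows "f \<in> borel_measurable (PiM S (\<lambda>_. borel))"
proof (rule measurable_discrete_difference[where f="\<lambda>_. 0" and X="subvec S ` C"])
  show "0 = f y" if "y \<in> space (PiM S (\<lambda>_. borel :: real measure))" "y \<notin> subvec S ` C" for y
  proof -
    have "AE x in P. x \<in> C" using P(1) C(2) by (rule AE_mem_of_measure_eq_1)
    moreover have "{y} \<in> sets (PiM S (\<lambda>_. borel :: real measure))"
      using that by (intro singleton_in_sets_PiM_borel) (simp_all add: space_PiM)
    then have "{x \<in> space P. subvec S x = y} \<in> sets P"
      by (rule fibre_in_sets[OF P(2)])
    ultimately have "emeasure P {x \<in> space P. subvec S x = y} = emeasure P {}"
      using that by (intro emeasure_eq_AE) auto
    then show ?thesis using that by (simp add: pS measure_def space_PiM)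
  qed
qed (use C subvec_in_PiE in \<open>auto intro!: singleton_in_sets_PiM_borel\<close>)

text \<open>Discrete counterpart of the almost sure positivity of a density: a union of countably
  many null fibres is null.\<close>

lemma AE_fibre_measure_pos:
  assumes "prob_space M" and Y: "Y \<in> M \<rightarrow>\<^sub>M N"
    and D: "countable D" "\<And>y. y \<in> D \<Longrightarrow> {y} \<in> sets N" "AE x in M. Y x \<in> D"
  shows "AE x in M. 0 < measure M {x' \<in> space M. Y x' = Y x}"
proof -
  interpret prob_space M by fact
  define Z where "Z = {y \<in> D. measure M {x \<in> space M. Y x = y} = 0}"
  have sets: "y \<in> D \<Longrightarrow> {x \<in> space M. Y x = y} \<in> sets M" for y
    using Y D(2) by (rule fibre_in_sets)
  have "AE x in M. \<forall>y\<in>Z. Y x \<noteq> y"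
  proof (subst AE_ball_countable)
    show "countable Z" unfolding Z_def using D(1) by (rule countable_subset[rotated]) auto
    show "\<forall>y\<in>Z. AE x in M. Y x \<noteq> y"
    proof
      fix y assume "y \<in> Z"
      then have "{x \<in> space M. Y x = y} \<in> null_sets M"
        using sets by (auto simp: Z_def null_sets_def emeasure_eq_measure)
      then show "AE x in M. Y x \<noteq> y"
        by (rule AE_I') auto
    qed
  qed
  with D(3) show ?thesis
  proof eventually_elim
    case (elim x)
    then have "measure M {x' \<in> space M. Y x' = Y x} \<noteq> 0" by (auto simp: Z_def)
    then show ?case by (simp add: zero_less_measure_iff)
  qed
qed

text \<open>Same cancellation as for densities, with the mass \<open>g y * h y\<close> of a fibre in
  place of the density and a sum over \<open>D\<close> in place of the integral.\<close>

lemma sub_likelihood_ratio_countable: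
  assumes "prob_space M" and Y: "Y \<in> M \<rightarrow>\<^sub>M N"
    and D: "countable D" "\<And>y. y \<in> D \<Longrightarrow> {y} \<in> sets N" "AE x in M. Y x \<in> D"
    and [measurable]: "f \<in> borel_measurable N" "g \<in> borel_measurable N"
    and nonneg: "\<And>y. y \<in> space N \<Longrightarrow> 0 \<le> f y" "\<And>y. y \<in> space N \<Longrightarrow> 0 \<le> g y"
      "\<And>y. y \<in> space N \<Longrightarrow> 0 \<le> h y"
    and pmf: "\<And>y. y \<in> space N \<Longrightarrow> measure M {x \<in> space M. Y x = y} = g y * h y"
    and int: "(\<integral>\<^sup>+ y. ennreal (f y * h y) \<partial>count_space D) \<le> 1"
  shows "sub_likelihood_ratio M (\<lambda>x. f (Y x)) (\<lambda>x. g (Y x))"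
proof -
  interpret prob_space M by fact
  note [measurable] = Y
  have Y_in: "x \<in> space M \<Longrightarrow> Y x \<in> space N" for x
    using Y by (rule measurable_space)
  have D_in: "y \<in> D \<Longrightarrow> y \<in> space N" for y
    using D(2)[THEN sets.sets_into_space] by auto
  have "(\<integral>\<^sup>+ x. ennreal (f (Y x) / g (Y x)) \<partial>M) =
      (\<integral>\<^sup>+ y. ennreal (f y / g y) * emeasure M {x \<in> space M. Y x = y} \<partial>count_space D)"
    using D by (intro nn_integral_countable_range[OF Y, where h="\<lambda>y. ennreal (f y / g y)"]) auto
  also have "\<dots> \<le> (\<integral>\<^sup>+ y. ennreal (f y * h y) \<partial>count_space D)"
  proof (intro nn_integral_mono)
    fix y assume "y \<in> space (count_space D)"
    then have y: "y \<in> space N" using D_in by simp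
    show "ennreal (f y / g y) * emeasure M {x \<in> space M. Y x = y} \<le> ennreal (f y * h y)"
      unfolding emeasure_eq_measure pmf[OF y]
      using nonneg[OF y] by (cases "g y = 0") (auto simp flip: ennreal_mult simp: ac_simps)
  qed
  also note int
  finally have "(\<integral>\<^sup>+ x. ennreal (f (Y x) / g (Y x)) \<partial>M) \<le> 1" .
  moreover have "AE x in M. 0 < g (Y x)"
  proof -
    have "AE x in M. 0 < measure M {x' \<in> space M. Y x' = Y x}"
      using assms(1) Y D by (rule AE_fibre_measure_pos)
    with AE_space show ?thesis
    proof eventually_elim
      case (elim x)
      then show ?case
        using pmf[OF Y_in, of x] nonneg(2)[OF Y_in, of x] by (cases "g (Y x) = 0") auto
    qed
  qed
  ultimately show ?thesis
    using nonneg Y_in by (auto simp: sub_likelihood_ratio_def)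
qed

text \<open>Fibres over distinct points are disjoint. \<open>D\<close> need not carry the law of
  \<open>Y\<close>, so the total may be less than 1.\<close>

lemma nn_integral_fibre_measure_le_1:
  assumes "prob_space M" and Y: "Y \<in> M \<rightarrow>\<^sub>M N" and D: "countable D" "\<And>y. y \<in> D \<Longrightarrow> {y} \<in> sets N"
  shows "(\<integral>\<^sup>+ y. ennreal (measure M {x \<in> space M. Y x = y}) \<partial>count_space D) \<le> 1"
proof -
  interpret prob_space M by fact
  have sets: "y \<in> D \<Longrightarrow> {x \<in> space M. Y x = y} \<in> sets M" for y
    using Y D(2) by (rule fibre_in_sets)
  have "(\<integral>\<^sup>+ y. emeasure M {x \<in> space M. Y x = y} \<partial>count_space D) =
      emeasure M (\<Union>y\<in>D. {x \<in> space M. Y x = y})"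
    using sets D(1) by (intro emeasure_UN_countable[symmetric]) (auto simp: disjoint_family_on_def)
  also have "\<dots> \<le> 1"
    by (rule measure_le_1[unfolded emeasure_eq_measure[symmetric]])
  finally show ?thesis by (simp add: emeasure_eq_measure)
qed

text \<open>The sum runs over the image of a countable set \<open>C\<close> carrying
  \<open>P\<close>. As \<open>Q\<close> may live partly elsewhere, the masses \<open>p' S\<close>
  add up to at most 1 there.\<close>

lemma has_pmfs_marginal_ratio:
  fixes P Q :: "(real ^ 'd::finite) measure"
  assumes "prob_space P" "prob_space Q"
    and sets: "sets P = sets (restrict_space borel \<X>)" "sets Q = sets (restrict_space borel \<X>)"
    and "has_pmfs P p c" "has_pmfs Q p' c'" and S: "S \<in> nonempty_subsets"
  shows "sub_likelihood_ratio P (\<lambda>x. p' S (subvec S x)) (\<lambda>x. p S (subvec S x))"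
proof -
  let ?N = "PiM S (\<lambda>_. borel :: real measure)"
  obtain C where C: "countable C" "measure P C = 1"
    using assms by (auto simp: has_pmfs_def)
  obtain C' where C': "countable C'" "measure Q C' = 1"
    using assms by (auto simp: has_pmfs_def)
  have p: "\<And>y. y \<in> S \<rightarrow>\<^sub>E UNIV \<Longrightarrow> p S y = measure P {x \<in> space P. subvec S x = y}"
    and p': "\<And>y. y \<in> S \<rightarrow>\<^sub>E UNIV \<Longrightarrow> p' S y = measure Q {x \<in> space Q. subvec S x = y}"
    using assms by (auto simp: has_pmfs_def)
  have space: "space ?N = S \<rightarrow>\<^sub>E UNIV"
    by (simp add: space_PiM)
  have D: "countable (subvec S ` C)" "\<And>y. y \<in> subvec S ` C \<Longrightarrow> {y} \<in> sets ?N"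
    using C(1) subvec_in_PiE by (auto intro!: singleton_in_sets_PiM_borel)
  show ?thesis
  proof (rule sub_likelihood_ratio_countable[where N="?N" and D="subvec S ` C" and h="\<lambda>_. 1"])
    show "subvec S \<in> P \<rightarrow>\<^sub>M ?N" using sets(1) by (rule measurable_subvec)
    show "AE x in P. subvec S x \<in> subvec S ` C"
      using AE_mem_of_measure_eq_1[OF assms(1) C(2)] by eventually_elim auto
    show "p S \<in> borel_measurable ?N"
      using assms(1) measurable_subvec[OF sets(1)] C p by (rule borel_measurable_marginal_pmf)
    show "p' S \<in> borel_measurable ?N"
      using assms(2) measurable_subvec[OF sets(2)] C' p' by (rule borel_measurable_marginal_pmf)
    have "(\<integral>\<^sup>+ y. ennreal (p' S y * 1) \<partial>count_space (subvec S ` C)) =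
        (\<integral>\<^sup>+ y. ennreal (measure Q {x \<in> space Q. subvec S x = y}) \<partial>count_space (subvec S ` C))"
      by (intro nn_integral_cong) (auto simp: p' subvec_in_PiE)
    also have "\<dots> \<le> 1"
      using assms(2) measurable_subvec[OF sets(2)] D by (rule nn_integral_fibre_measure_le_1)
    finally show "(\<integral>\<^sup>+ y. ennreal (p' S y * 1) \<partial>count_space (subvec S ` C)) \<le> 1" .
  qed (use D assms(1) in \<open>auto simp: space p p'\<close>)
qed

lemma has_pmfs_conditionalD:
  assumes "has_pmfs P p c" "(A, B) \<in> disjoint_pairs"
  shows "(\<lambda>(y, z). c (A, B) y z) \<in> borel_measurable (PiM A (\<lambda>_. borel) \<Otimes>\<^sub>M PiM B (\<lambda>_. borel))"
    and "\<And>z y. z \<in> B \<rightarrow>\<^sub>E UNIV \<Longrightarrow> y \<in> A \<rightarrow>\<^sub>E UNIV \<Longrightarrow> 0 \<le> c (A, B) y z"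
    and "\<And>z y. z \<in> B \<rightarrow>\<^sub>E UNIV \<Longrightarrow> y \<in> A \<rightarrow>\<^sub>E UNIV \<Longrightarrow>
      measure P {x \<in> space P. subvec A x = y \<and> subvec B x = z} = c (A, B) y z * p B z"
    and "\<And>z. z \<in> B \<rightarrow>\<^sub>E UNIV \<Longrightarrow> ((\<lambda>y. c (A, B) y z) has_sum 1) (A \<rightarrow>\<^sub>E UNIV)"
proof -
  note * = bspec[OF assms(1)[unfolded has_pmfs_def, THEN conjunct2, THEN conjunct2] assms(2),
    unfolded prod.case]
  note meas = *[THEN conjunct1]
    and dens = *[THEN conjunct2, THEN conjunct1, THEN bspec]
    and chain = *[THEN conjunct2, THEN conjunct2, THEN bspec, THEN bspec]
  show "(\<lambda>(y, z). c (A, B) y z) \<in> borel_measurable (PiM A (\<lambda>_. borel) \<Otimes>\<^sub>M PiM B (\<lambda>_. borel))"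
    by (rule meas)
  show "0 \<le> c (A, B) y z" if "z \<in> B \<rightarrow>\<^sub>E UNIV" "y \<in> A \<rightarrow>\<^sub>E UNIV" for z y
    using dens[OF that(1), THEN conjunct1] that(2) by (rule bspec)
  show "measure P {x \<in> space P. subvec A x = y \<and> subvec B x = z} = c (A, B) y z * p B z"
    if "z \<in> B \<rightarrow>\<^sub>E UNIV" "y \<in> A \<rightarrow>\<^sub>E UNIV" for z y
    using that(2,1) by (rule chain)
  show "((\<lambda>y. c (A, B) y z) has_sum 1) (A \<rightarrow>\<^sub>E UNIV)" if "z \<in> B \<rightarrow>\<^sub>E UNIV" for z
    using dens[OF that] by (rule conjunct2)
qed

text \<open>As for densities, \<open>c'\<close> is mixed with the mass function \<open>p B\<close>
  of \<open>P\<close>. For each \<open>z\<close> the values of \<open>c'\<close> sum to 1 over all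
  subvectors, hence to at most 1 over \<open>?C\<close>, and the masses \<open>p B\<close> sum to at
  most 1 over \<open>?D\<close>.\<close>

lemma has_pmfs_conditional_ratio:
  fixes P Q :: "(real ^ 'd::finite) measure"
  assumes "prob_space P" and sets: "sets P = sets (restrict_space borel \<X>)"
    and "has_pmfs P p c" "has_pmfs Q p' c'" "T \<in> disjoint_pairs"
  shows "sub_likelihood_ratio P (\<lambda>x. c' T (subvec (fst T) x) (subvec (snd T) x))
    (\<lambda>x. c T (subvec (fst T) x) (subvec (snd T) x))"
proof -
  obtain A B where T: "T = (A, B)" by force
  let ?A = "PiM A (\<lambda>_. borel :: real measure)" and ?B = "PiM B (\<lambda>_. borel :: real measure)"
  obtain C where C: "countable C" "measure P C = 1"
    using assms by (auto simp: has_pmfs_def)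
  let ?C = "subvec A ` C" and ?D = "subvec B ` C"
  have "B \<in> nonempty_subsets"
    using assms(5) by (auto simp: T disjoint_pairs_def nonempty_subsets_def)
  then have p: "\<And>z. z \<in> B \<rightarrow>\<^sub>E UNIV \<Longrightarrow> p B z = measure P {x \<in> space P. subvec B x = z}"
    using assms(3) by (auto simp: has_pmfs_def)
  have AB: "(A, B) \<in> disjoint_pairs" using assms(5) T by simp
  note c = has_pmfs_conditionalD[OF assms(3) AB] and c' = has_pmfs_conditionalD[OF assms(4) AB]
  have space: "space (?A \<Otimes>\<^sub>M ?B) = (A \<rightarrow>\<^sub>E UNIV) \<times> (B \<rightarrow>\<^sub>E UNIV)"
    by (simp add: space_PiM space_pair_measure)
  have count: "countable ?C" "countable ?D"
    using C(1) by auto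
  have sing: "z \<in> ?D \<Longrightarrow> {z} \<in> sets ?B" "y \<in> ?C \<Longrightarrow> {y} \<in> sets ?A" for y z
    using subvec_in_PiE by (auto intro!: singleton_in_sets_PiM_borel)
  have "sub_likelihood_ratio P (\<lambda>x. (\<lambda>(y, z). c' (A, B) y z) (subvec A x, subvec B x))
      (\<lambda>x. (\<lambda>(y, z). c (A, B) y z) (subvec A x, subvec B x))"
  \<comment> \<open>A full rectangle is taken, not just the image of \<open>C\<close> under the pair
    map, so that counting measure on it is a product and the double sum can be iterated.\<close>
  proof (rule sub_likelihood_ratio_countable[where N="?A \<Otimes>\<^sub>M ?B" and D="?C \<times> ?D" and h="\<lambda>(y, z). p B z"])
    show "(\<lambda>x. (subvec A x, subvec B x)) \<in> P \<rightarrow>\<^sub>M ?A \<Otimes>\<^sub>M ?B"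
      using measurable_subvec[OF sets] by (intro measurable_Pair) auto
    show "AE x in P. (subvec A x, subvec B x) \<in> ?C \<times> ?D"
      using AE_mem_of_measure_eq_1[OF assms(1) C(2)] by eventually_elim auto
    show "{yz} \<in> sets (?A \<Otimes>\<^sub>M ?B)" if "yz \<in> ?C \<times> ?D" for yz
    proof -
      have "{fst yz} \<times> {snd yz} \<in> sets (?A \<Otimes>\<^sub>M ?B)"
        using that sing by (intro pair_measureI) auto
      then show ?thesis by simp
    qed
    interpret AB: pair_sigma_finite "count_space ?C" "count_space ?D"
      using count by (intro pair_sigma_finite.intro sigma_finite_measure_count_space_countable)
    have "(\<integral>\<^sup>+ y. ennreal ((case y of (y, z) \<Rightarrow> c' (A, B) y z) * (case y of (y, z) \<Rightarrow> p B z)) \<partial>count_space (?C \<times> ?D))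
        = (\<integral>\<^sup>+ z. (\<integral>\<^sup>+ y. ennreal (c' (A, B) y z * p B z) \<partial>count_space ?C) \<partial>count_space ?D)"
      unfolding pair_measure_countable[OF count, symmetric]
      by (subst AB.nn_integral_snd[symmetric]) (auto simp: pair_measure_countable[OF count])
    also have "\<dots> \<le> (\<integral>\<^sup>+ z. ennreal (measure P {x \<in> space P. subvec B x = z}) \<partial>count_space ?D)"
    proof (intro nn_integral_mono)
      fix z assume "z \<in> space (count_space ?D)"
      then have z: "z \<in> B \<rightarrow>\<^sub>E UNIV" using subvec_in_PiE by auto
      have "(\<integral>\<^sup>+ y. ennreal (c' (A, B) y z * p B z) \<partial>count_space ?C)
          = (\<integral>\<^sup>+ y. ennreal (c' (A, B) y z) * ennreal (p B z) \<partial>count_space ?C)"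
        using c'(2)[OF z] subvec_in_PiE by (intro nn_integral_cong ennreal_mult) (auto simp: p z)
      also have "\<dots> = (\<integral>\<^sup>+ y. ennreal (c' (A, B) y z) \<partial>count_space ?C) * ennreal (p B z)"
        by (rule nn_integral_multc) auto
      also have "\<dots> \<le> ennreal 1 * ennreal (p B z)"
      proof (rule mult_right_mono)
        have "?C \<subseteq> A \<rightarrow>\<^sub>E UNIV" using subvec_in_PiE by blast
        with c'(4)[OF z] c'(2)[OF z] show "(\<integral>\<^sup>+ y. ennreal (c' (A, B) y z) \<partial>count_space ?C) \<le> ennreal 1"
          by (rule nn_integral_has_sum_subset_le)
      qed simp
      finally show "(\<integral>\<^sup>+ y. ennreal (c' (A, B) y z * p B z) \<partial>count_space ?C) \<le>
          ennreal (measure P {x \<in> space P. subvec B x = z})"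
        by (simp add: p z)
    qed
    also have "\<dots> \<le> 1"
      using assms(1) measurable_subvec[OF sets] count(2) sing(1) by (rule nn_integral_fibre_measure_le_1)
    finally show "(\<integral>\<^sup>+ y. ennreal ((case y of (y, z) \<Rightarrow> c' (A, B) y z) *
        (case y of (y, z) \<Rightarrow> p B z)) \<partial>count_space (?C \<times> ?D)) \<le> 1" .
    show "0 \<le> (case yz of (y, z) \<Rightarrow> c (A, B) y z)" "0 \<le> (case yz of (y, z) \<Rightarrow> c' (A, B) y z)"
        "0 \<le> (case yz of (y, z) \<Rightarrow> p B z)"
        "measure P {x \<in> space P. (subvec A x, subvec B x) = yz} =
          (case yz of (y, z) \<Rightarrow> c (A, B) y z) * (case yz of (y, z) \<Rightarrow> p B z)"
      if "yz \<in> space (?A \<Otimes>\<^sub>M ?B)" for yz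
    proof -
      obtain y z where yz: "yz = (y, z)" "y \<in> A \<rightarrow>\<^sub>E UNIV" "z \<in> B \<rightarrow>\<^sub>E UNIV"
        using \<open>yz \<in> _\<close> unfolding space by blast
      show "0 \<le> (case yz of (y, z) \<Rightarrow> c (A, B) y z)" "0 \<le> (case yz of (y, z) \<Rightarrow> c' (A, B) y z)"
        using c(2) c'(2) yz(2,3) by (simp_all add: yz(1))
      show "0 \<le> (case yz of (y, z) \<Rightarrow> p B z)"
        by (simp add: yz(1) p[OF yz(3)])
      show "measure P {x \<in> space P. (subvec A x, subvec B x) = yz} =
          (case yz of (y, z) \<Rightarrow> c (A, B) y z) * (case yz of (y, z) \<Rightarrow> p B z)"
        using c(3)[OF yz(3,2)] by (simp add: yz(1))
    qed
  qed (use assms(1) count c(1) c'(1) in auto)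
  then show ?thesis by (simp add: T)
qed

subsection \<open>Composite likelihoods\<close>

text \<open>The disjoint sum of the index sets merges marginal and conditional factors into one
  weighted geometric mean, whose normalised weights sum to 1 only jointly.\<close>

lemma comp_lik_eq_prod_Plus:
  "comp_lik a b p c x =
     (\<Prod>i\<in>nonempty_subsets <+> disjoint_pairs.
        rpow (case_sum (\<lambda>S. p S (subvec S x)) (\<lambda>T. c T (subvec (fst T) x) (subvec (snd T) x)) i)
          (case_sum a b i / total_weight a b))"
  by (simp add: comp_lik_def prod.Plus)

lemma sub_likelihood_ratio_comp_lik:
  assumes S: "\<And>S. S \<in> nonempty_subsets \<Longrightarrow>
      sub_likelihood_ratio P (\<lambda>x. p' S (subvec S x)) (\<lambda>x. p S (subvec S x))"
    and T: "\<And>T. T \<in> disjoint_pairs \<Longrightarrow>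
      sub_likelihood_ratio P (\<lambda>x. c' T (subvec (fst T) x) (subvec (snd T) x))
        (\<lambda>x. c T (subvec (fst T) x) (subvec (snd T) x))"
    and w: "\<forall>S\<in>nonempty_subsets. 0 \<le> a S" "\<forall>T\<in>disjoint_pairs. 0 \<le> b T" "0 < total_weight a b"
  shows "sub_likelihood_ratio P (comp_lik a b p' c') (comp_lik a b p c)"
  unfolding comp_lik_eq_prod_Plus[abs_def]
proof (rule sub_likelihood_ratio_prod)
  show "(\<Sum>i\<in>nonempty_subsets <+> disjoint_pairs. case_sum a b i / total_weight a b) = 1"
    using w(3) by (simp add: sum.Plus total_weight_def flip: sum_divide_distrib add_divide_distrib)
qed (use S T w in auto)

text \<open>For \<open>i = 0\<close> the restriction would discard the observation
  \<open>x i\<close> itself.\<close>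

lemma plugin_lik_restrict: "i \<ge> 1 \<Longrightarrow> plugin_lik a b p c est i (restrict x {1..i}) = plugin_lik a b p c est i x"
  by (simp add: plugin_lik_def Int_absorb1)

lemma comp_lik_nonneg: "0 \<le> comp_lik a b p c x"
  unfolding comp_lik_def by (intro mult_nonneg_nonneg prod_nonneg) (auto simp: rpow_nonneg)

lemma sub_likelihood_ratio_model:
  assumes "\<forall>\<theta>\<in>\<Theta>. prob_space (P \<theta>) \<and> sets (P \<theta>) = sets (restrict_space borel \<X>)"
    and "(\<forall>\<theta>\<in>\<Theta>. has_pdfs (P \<theta>) (p \<theta>) (c \<theta>)) \<or> (\<forall>\<theta>\<in>\<Theta>. has_pmfs (P \<theta>) (p \<theta>) (c \<theta>))"
    and "\<forall>S\<in>nonempty_subsets. 0 \<le> a S" "\<forall>T\<in>disjoint_pairs. 0 \<le> b T" "0 < total_weight a b"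
    and \<theta>: "\<theta> \<in> \<Theta>" "\<theta>' \<in> \<Theta>"
  shows "sub_likelihood_ratio (P \<theta>) (comp_lik a b (p \<theta>') (c \<theta>')) (comp_lik a b (p \<theta>) (c \<theta>))"
proof (rule sub_likelihood_ratio_comp_lik)
  have P: "prob_space (P \<theta>)" "prob_space (P \<theta>')" "sets (P \<theta>) = sets (restrict_space borel \<X>)"
    "sets (P \<theta>') = sets (restrict_space borel \<X>)"
    using assms(1) \<theta> by auto
  \<comment> \<open>The alternative is decided for the whole family, so both parameters fall into
    the same case.\<close>
  have dens: "has_pdfs (P \<theta>) (p \<theta>) (c \<theta>) \<and> has_pdfs (P \<theta>') (p \<theta>') (c \<theta>') \<or>
      has_pmfs (P \<theta>) (p \<theta>) (c \<theta>) \<and> has_pmfs (P \<theta>') (p \<theta>') (c \<theta>')"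
    using assms(2) \<theta> by blast
  show "sub_likelihood_ratio (P \<theta>) (\<lambda>x. p \<theta>' S (subvec S x)) (\<lambda>x. p \<theta> S (subvec S x))"
    if "S \<in> nonempty_subsets" for S
    using dens
  proof (elim disjE conjE)
    assume "has_pdfs (P \<theta>) (p \<theta>) (c \<theta>)" "has_pdfs (P \<theta>') (p \<theta>') (c \<theta>')"
    from P(1,2) this that show ?thesis by (rule has_pdfs_marginal_ratio)
  next
    assume "has_pmfs (P \<theta>) (p \<theta>) (c \<theta>)" "has_pmfs (P \<theta>') (p \<theta>') (c \<theta>')"
    from P this that show ?thesis by (rule has_pmfs_marginal_ratio)
  qed
  show "sub_likelihood_ratio (P \<theta>) (\<lambda>x. c \<theta>' T (subvec (fst T) x) (subvec (snd T) x))
      (\<lambda>x. c \<theta> T (subvec (fst T) x) (subvec (snd T) x))" if "T \<in> disjoint_pairs" for T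
    using dens
  proof (elim disjE conjE)
    assume "has_pdfs (P \<theta>) (p \<theta>) (c \<theta>)" "has_pdfs (P \<theta>') (p \<theta>') (c \<theta>')"
    from P(1) this that show ?thesis by (rule has_pdfs_conditional_ratio)
  next
    assume "has_pmfs (P \<theta>) (p \<theta>) (c \<theta>)" "has_pmfs (P \<theta>') (p \<theta>') (c \<theta>')"
    from P(1,3) this that show ?thesis by (rule has_pmfs_conditional_ratio)
  qed
qed fact+

section \<open>Coverage of the confidence sequence and of its running intersection\<close>

theorem proposition5:
  fixes \<X> :: "(real ^ 'd::finite) set"
    and \<Theta> :: "(real ^ 'q::finite) set"
    and P :: "real ^ 'q \<Rightarrow> (real ^ 'd) measure"
    and p :: "real ^ 'q \<Rightarrow> 'd set \<Rightarrow> ('d \<Rightarrow> real) \<Rightarrow> real"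
    and c :: "real ^ 'q \<Rightarrow> 'd set \<times> 'd set \<Rightarrow> ('d \<Rightarrow> real) \<Rightarrow> ('d \<Rightarrow> real) \<Rightarrow> real"
    and a :: "'d set \<Rightarrow> real"
    and b :: "'d set \<times> 'd set \<Rightarrow> real"
    and est :: "nat \<Rightarrow> (nat \<Rightarrow> real ^ 'd) \<Rightarrow> real ^ 'q"
    and M :: "'w measure"
    and X :: "nat \<Rightarrow> 'w \<Rightarrow> real ^ 'd"
    and \<theta>s :: "real ^ 'q"
    and \<alpha> :: real
  assumes "\<forall>\<theta>\<in>\<Theta>. prob_space (P \<theta>) \<and> sets (P \<theta>) = sets (restrict_space borel \<X>)"
    and "(\<forall>\<theta>\<in>\<Theta>. has_pdfs (P \<theta>) (p \<theta>) (c \<theta>)) \<or> (\<forall>\<theta>\<in>\<Theta>. has_pmfs (P \<theta>) (p \<theta>) (c \<theta>))"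
    and "\<forall>S\<in>nonempty_subsets. 0 \<le> a S"
    and "\<forall>T\<in>disjoint_pairs. 0 \<le> b T"
    and "0 < total_weight a b"
    and "nonanticipating a b \<X> \<Theta> p c est"
    and "0 < \<alpha>" and "\<alpha> < 1"
    and "\<theta>s \<in> \<Theta>"
    and "prob_space M"
    and "prob_space.indep_vars M (\<lambda>_. restrict_space borel \<X>) X {1..}"
    and "\<forall>i\<ge>1. distr M (restrict_space borel \<X>) (X i) = P \<theta>s"
  shows "measure M {\<omega> \<in> space M. \<forall>n\<ge>1. \<theta>s \<in> conf_set a b \<Theta> p c est \<alpha> (\<lambda>i. X i \<omega>) n} \<ge> 1 - \<alpha> \<and>
    measure M {\<omega> \<in> space M. \<forall>n\<ge>1. \<theta>s \<in> running_conf_set a b \<Theta> p c est \<alpha> (\<lambda>i. X i \<omega>) n} \<ge> 1 - \<alpha>"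
proof -
  interpret prob_space M by fact
  let ?N = "restrict_space borel \<X>" and ?q = "\<lambda>\<theta>. comp_lik a b (p \<theta>) (c \<theta>)"
  define L where "L = (\<lambda>n x. ennreal (plugin_lik a b p c est n x) / ennreal (?q \<theta>s (x n)))"
  have lr: "sub_likelihood_ratio (P \<theta>s) (?q \<theta>) (?q \<theta>s)" if "\<theta> \<in> \<Theta>" for \<theta>
    using assms(1-5,9) that by (rule sub_likelihood_ratio_model)
  have "sets (P \<theta>s) = sets ?N"
    using assms(1,9) by blast
  then have meas_q: "?q \<theta>s \<in> borel_measurable ?N"
    using lr[OF assms(9)] measurable_cong_sets by (auto simp: sub_likelihood_ratio_def)
  have est: "est k \<in> PiM {1..k} (\<lambda>_. ?N) \<rightarrow>\<^sub>M restrict_space borel \<Theta>" for k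
    using assms(6) by (auto simp: nonanticipating_def)
  have meas_plugin: "n \<ge> 1 \<Longrightarrow> plugin_lik a b p c est n \<in> borel_measurable (PiM {1..n} (\<lambda>_. ?N))" for n
    using assms(6) by (auto simp: nonanticipating_def)
  have meas_L: "L n \<in> borel_measurable (PiM {1..n} (\<lambda>_. ?N))" if n: "n \<ge> 1" for n
  proof -
    have [measurable]: "(\<lambda>x. ?q \<theta>s (x n)) \<in> borel_measurable (PiM {1..n} (\<lambda>_. ?N))"
      using n by (intro measurable_compose[OF _ meas_q] measurable_component_singleton) auto
    show ?thesis
      unfolding L_def using meas_plugin[OF n] by measurable
  qed
  \<comment> \<open>Factor \<open>Suc n\<close> uses the estimate from the first \<open>n\<close>
    observations, which the new value \<open>y\<close> does not touch. Given the past,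
    \<open>est n x\<close> is thus a fixed parameter in \<Theta>, and the bound for a fixed
    parameter applies.\<close>
  have int_L: "(\<integral>\<^sup>+ y. L (Suc n) (x(Suc n := y)) \<partial>P \<theta>s) \<le> 1"
    if x: "x \<in> space (PiM {1..n} (\<lambda>_. ?N))" for n x
  proof -
    have "restrict (x(Suc n := y)) {1..n} = x" for y
      using x by (auto simp: space_PiM PiE_def extensional_def fun_eq_iff)
    then have "L (Suc n) (x(Suc n := y)) = ennreal (?q (est n x) y) / ennreal (?q \<theta>s y)" for y
      by (simp add: L_def plugin_lik_def Let_def)
    moreover have "est n x \<in> \<Theta>"
      using measurable_space[OF est x] by (simp add: space_restrict_space)
    ultimately show ?thesis
      using sub_likelihood_ratio_ennreal[OF lr] by simp
  qed
  define E where
    "E = {\<omega> \<in> space M. \<exists>n\<ge>1. (\<Prod>i=1..n. L i (restrict (\<lambda>j. X j \<omega>) {1..i})) > ennreal (1 / \<alpha>)}"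
  have distr: "distr M ?N (X i) = P \<theta>s" if "i \<ge> 1" for i
    using assms(12) that by blast
  have "1 \<le> 1 / \<alpha>"
    using assms(7,8) by simp
  note ville = ville_inequality_prod[OF assms(11) distr meas_L int_L this, folded E_def]
  have E: "E \<in> events" "emeasure M E \<le> ennreal (1 / (1 / \<alpha>))"
    by (rule ville; assumption)+
  have ratio: "(\<Prod>i=1..n. L i (restrict (\<lambda>j. X j \<omega>) {1..i})) = cl_ratio a b p c est (\<lambda>i. X i \<omega>) n \<theta>s" for n \<omega>
  proof -
    have "(\<Prod>i=1..n. L i (restrict (\<lambda>j. X j \<omega>) {1..i})) =
        (\<Prod>i=1..n. ennreal (plugin_lik a b p c est i (\<lambda>i. X i \<omega>)) / ennreal (?q \<theta>s (X i \<omega>)))"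
      by (intro prod.cong) (auto simp: L_def plugin_lik_restrict simp del: One_nat_def)
    also have "\<dots> = cl_ratio a b p c est (\<lambda>i. X i \<omega>) n \<theta>s"
      unfolding cl_ratio_def
      by (rule ennreal_prod_divide) (auto simp: plugin_lik_def Let_def comp_lik_nonneg)
    finally show ?thesis .
  qed
  \<comment> \<open>Coverage at all times is exactly the event that the ratio never exceeds
    \<open>1 / \<alpha>\<close>.\<close>
  have conf: "{\<omega> \<in> space M. \<forall>n\<ge>1. \<theta>s \<in> conf_set a b \<Theta> p c est \<alpha> (\<lambda>i. X i \<omega>) n} = space M - E"
    unfolding E_def ratio conf_set_def using assms(9) by (auto simp: not_less)
  \<comment> \<open>Once all times are required simultaneously, intersecting over earlier times adds
    no constraint; conversely \<open>m = n\<close> is among the intersected times.\<close>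
  have running: "(\<forall>n\<ge>1. \<theta>s \<in> running_conf_set a b \<Theta> p c est \<alpha> (\<lambda>i. X i \<omega>) n) \<longleftrightarrow>
      (\<forall>n\<ge>1. \<theta>s \<in> conf_set a b \<Theta> p c est \<alpha> (\<lambda>i. X i \<omega>) n)" for \<omega>
    by (auto simp: running_conf_set_def simp del: One_nat_def)
  have "prob E \<le> \<alpha>"
    using E(2) assms(7) by (simp add: emeasure_eq_measure)
  then have "1 - \<alpha> \<le> prob (space M - E)"
    using E(1) by (simp add: prob_compl)
  then show ?thesis
    unfolding running conf by simp
qed

end
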